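(* Let $t_0<t_1$ be real numbers, let $X\neq\{0\}$ be a Banach space, and assume that $1\le p\le\infty$. If $A:D(A)\subset L^p(t_0,t_1;X)\to L^p(t_0,t_1;X)$ is the infinitesimal generator of the $C_0$-semigroup $\{J^\alpha_{t_0,t}:\alpha\ge0\}\subset\mathcal{L}(L^p(t_0,t_1;X))$, then $A:D(A)\subset L^p(t_0,t_1;X)\to L^p(t_0,t_1;X)$ is an unbounded operator.
   Context: $L^p(t_0,t_1;X)$ is the Bochner-Lebesgue space on $[t_0,t_1]$ with its usual norm, and $\mathcal{L}(Y)$ denotes the bounded linear operators from a Banach space $Y$ into itself. For $\alpha>0$, $J^\alpha_{t_0,t}$ is the bounded linear operator from $L^p(t_0,t_1;X)$ into itself sending $f$ to the (a.e. defined) function $t\mapsto J^\alpha_{t_0,t}f(t):=\frac{1}{\Gamma(\alpha)}\int_{t_0}^t(t-s)^{\alpha-1}f(s)\,ds$ (Bochner integral), and $J^0_{t_0,t}:=Id$. A family $\{T(\alpha):\alpha\ge0\}\subset\mathcal{L}(Y)$ is a semigroup if $T(0)=Id$ and $T(\alpha+\beta)=T(\alpha)T(\beta)$ for all $\alpha,\beta\ge0$; it is a $C_0$-semigroup if moreover $\lim_{\alpha\to0^+}\|T(\alpha)y-y\|_Y=0$ for every $y\in Y$. The infinitesimal generator $A$ of such a semigroup has domain $D(A)$ consisting of all $y\in Y$ for which $\lim_{\alpha\to0^+}\frac{T(\alpha)y-y}{\alpha}$ exists in $Y$, and $Ay$ is this limit. The paper takes $\{J^\alpha_{t_0,t}:\alpha\ge0\}$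 to be a $C_0$-semigroup in $L^p(t_0,t_1;X)$ for every $1\le p\le\infty$. *)

theory Defs
  imports "HOL-Analysis.Analysis" "HOL-Probability.Essential_Supremum"
begin

section \<open>Strong measurability and the Bochner integral\<close>

text \<open>
  The library's Bochner integral is restricted to second countable spaces, i.e. to separable
  Banach spaces. The same construction is repeated here without that restriction; Borel
  measurability is replaced by strong measurability, since the two differ in nonseparable spaces.
\<close>

definition strongly_measurable :: "'s measure \<Rightarrow> ('s \<Rightarrow> 'a::real_normed_vector) \<Rightarrow> bool" where
  "strongly_measurable M f \<longleftrightarrow>
     (\<exists>s. (\<forall>i::nat. simple_function M (s i)) \<and> (AE x in M. (\<lambda>i. s i x) \<longlonglongrightarrow> f x))"

definition has_Bochner_integral ::
    "'s measure \<Rightarrow> ('s \<Rightarrow> 'a::real_normed_vector) \<Rightarrow> 'a \<Rightarrow> bool" where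
  "has_Bochner_integral M f I \<longleftrightarrow>
     strongly_measurable M f \<and>
     (\<exists>s. (\<forall>i::nat. Bochner_Integration.simple_bochner_integrable M (s i)) \<and>
          (\<lambda>i. \<integral>\<^sup>+x. ennreal (norm (f x - s i x)) \<partial>M) \<longlonglongrightarrow> 0 \<and>
          (\<lambda>i. Bochner_Integration.simple_bochner_integral M (s i)) \<longlonglongrightarrow> I)"

text \<open>As in the library, the integral of a function that is not integrable is \<open>0\<close>.\<close>

definition Bochner_integral :: "'s measure \<Rightarrow> ('s \<Rightarrow> 'a::real_normed_vector) \<Rightarrow> 'a" where
  "Bochner_integral M f =
     (if \<exists>I. has_Bochner_integral M f I then THE I. has_Bochner_integral M f I else 0)"


section \<open>Semigroups on a normed space with explicit carrier\<close>

text \<open>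
  The Lebesgue spaces below depend on the values \<open>t0\<close>, \<open>t1\<close>, \<open>p\<close> and hence cannot be
  instances of the normed space type classes.
\<close>

record 'y nspace =
  vcarrier :: "'y set"
  vadd :: "'y \<Rightarrow> 'y \<Rightarrow> 'y"
  vscale :: "real \<Rightarrow> 'y \<Rightarrow> 'y"
  vnorm :: "'y \<Rightarrow> real"

definition vdiff :: "'y nspace \<Rightarrow> 'y \<Rightarrow> 'y \<Rightarrow> 'y" where
  "vdiff Y y z = vadd Y y (vscale Y (-1) z)"

definition generator_limit :: "'y nspace \<Rightarrow> (real \<Rightarrow> 'y \<Rightarrow> 'y) \<Rightarrow> 'y \<Rightarrow> 'y \<Rightarrow> bool" where
  "generator_limit Y T y z \<longleftrightarrow>
     z \<in> vcarrier Y \<and>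
     ((\<lambda>\<alpha>. vnorm Y (vdiff Y (vscale Y (1 / \<alpha>) (vdiff Y (T \<alpha> y) y)) z)) \<longlongrightarrow> 0) (at_right 0)"

text \<open>
  The generator depends on the family \<open>T\<close> alone. Strong continuity is deliberately not part of this
  predicate: fractional integration is not strongly continuous for \<open>p = \<infinity>\<close>, and
  requiring it would make that case vacuous.
\<close>

definition infinitesimal_generator ::
    "'y nspace \<Rightarrow> (real \<Rightarrow> 'y \<Rightarrow> 'y) \<Rightarrow> 'y set \<Rightarrow> ('y \<Rightarrow> 'y) \<Rightarrow> bool" where
  "infinitesimal_generator Y T D A \<longleftrightarrow>
     D = {y \<in> vcarrier Y. \<exists>z. generator_limit Y T y z} \<and>
     (\<forall>y\<in>D. generator_limit Y T y (A y))"

definition bounded_operator :: "'y nspace \<Rightarrow> 'y set \<Rightarrow> ('y \<Rightarrow> 'y) \<Rightarrow> bool" where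
  "bounded_operator Y D A \<longleftrightarrow> (\<exists>C. \<forall>y\<in>D. vnorm Y (A y) \<le> C * vnorm Y y)"

abbreviation unbounded_operator :: "'y nspace \<Rightarrow> 'y set \<Rightarrow> ('y \<Rightarrow> 'y) \<Rightarrow> bool" where
  "unbounded_operator Y D A \<equiv> \<not> bounded_operator Y D A"


section \<open>Bochner-Lebesgue spaces\<close>

definition Lp_functions :: "'s measure \<Rightarrow> ennreal \<Rightarrow> ('s \<Rightarrow> 'a::real_normed_vector) set" where
  "Lp_functions M p =
     {f. strongly_measurable M f \<and>
         (if p = \<infinity> then esssup M (\<lambda>x. ennreal (norm (f x))) < \<infinity>
          else (\<integral>\<^sup>+x. ennreal (norm (f x) powr enn2real p) \<partial>M) < \<infinity>)}"

definition Lp_seminorm :: "'s measure \<Rightarrow> ennreal \<Rightarrow> ('s \<Rightarrow> 'a::real_normed_vector) \<Rightarrow> real" where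
  "Lp_seminorm M p f =
     (if p = \<infinity> then enn2real (esssup M (\<lambda>x. ennreal (norm (f x))))
      else enn2real (\<integral>\<^sup>+x. ennreal (norm (f x) powr enn2real p) \<partial>M) powr (1 / enn2real p))"

definition Lp_rel ::
    "'s measure \<Rightarrow> ennreal \<Rightarrow> (('s \<Rightarrow> 'a::real_normed_vector) \<times> ('s \<Rightarrow> 'a)) set" where
  "Lp_rel M p =
     {(f, g). f \<in> Lp_functions M p \<and> g \<in> Lp_functions M p \<and> (AE x in M. f x = g x)}"

definition Lp_class ::
    "'s measure \<Rightarrow> ennreal \<Rightarrow> ('s \<Rightarrow> 'a::real_normed_vector) \<Rightarrow> ('s \<Rightarrow> 'a) set" where
  "Lp_class M p f = Lp_rel M p `` {f}"

definition Lp_rep :: "('s \<Rightarrow> 'a) set \<Rightarrow> 's \<Rightarrow> 'a" where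
  "Lp_rep F = (SOME f. f \<in> F)"

text \<open>
  The operations on equivalence classes are defined through an arbitrary representative; that the
  choice is irrelevant (for complete \<open>M\<close>) is shown at the end of this theory.
\<close>

definition Lp :: "'s measure \<Rightarrow> ennreal \<Rightarrow> ('s \<Rightarrow> 'a::real_normed_vector) set nspace" where
  "Lp M p =
     \<lparr>vcarrier = Lp_functions M p // Lp_rel M p,
      vadd = (\<lambda>F G. Lp_class M p (\<lambda>x. Lp_rep F x + Lp_rep G x)),
      vscale = (\<lambda>c F. Lp_class M p (\<lambda>x. c *\<^sub>R Lp_rep F x)),
      vnorm = (\<lambda>F. Lp_seminorm M p (Lp_rep F))\<rparr>"

text \<open>
  Elements are classes of total functions on the reals, identified if they agree almost everywhere
  on the interval; the values outside the interval are irrelevant.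
\<close>

definition Lp_interval ::
    "ennreal \<Rightarrow> real \<Rightarrow> real \<Rightarrow> (real \<Rightarrow> 'a::real_normed_vector) set nspace" where
  "Lp_interval p t0 t1 = Lp (lebesgue_on {t0..t1}) p"


section \<open>Riemann-Liouville fractional integrals\<close>

definition RL_integral :: "real \<Rightarrow> real \<Rightarrow> (real \<Rightarrow> 'a::real_normed_vector) \<Rightarrow> real \<Rightarrow> 'a" where
  "RL_integral t0 \<alpha> f t =
     (if \<alpha> = 0 then f t
      else (1 / Gamma \<alpha>) *\<^sub>R
        Bochner_integral (lebesgue_on {t0..t}) (\<lambda>s. (t - s) powr (\<alpha> - 1) *\<^sub>R f s))"

definition RL_operator ::
    "ennreal \<Rightarrow> real \<Rightarrow> real \<Rightarrow> real \<Rightarrow> (real \<Rightarrow> 'a::real_normed_vector) set \<Rightarrow> (real \<Rightarrow> 'a) set" where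
  "RL_operator p t0 t1 \<alpha> F = Lp_class (lebesgue_on {t0..t1}) p (RL_integral t0 \<alpha> (Lp_rep F))"


section \<open>Independence of representatives\<close>

lemma Lp_rep_class:
  assumes "f \<in> Lp_functions M p"
  shows "Lp_rep (Lp_class M p f) \<in> Lp_functions M p"
    and "AE x in M. Lp_rep (Lp_class M p f) x = f x"
proof -
  have "f \<in> Lp_class M p f"
    using assms by (simp add: Lp_class_def Lp_rel_def)
  then have "Lp_rep (Lp_class M p f) \<in> Lp_class M p f"
    unfolding Lp_rep_def by (rule someI[where P = "\<lambda>g. g \<in> Lp_class M p f"])
  then show "Lp_rep (Lp_class M p f) \<in> Lp_functions M p"
    and "AE x in M. Lp_rep (Lp_class M p f) x = f x"
    by (auto simp: Lp_class_def Lp_rel_def elim: eventually_mono)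
qed

lemma strongly_measurable_cong_AE:
  assumes "AE x in M. f x = g x" and "strongly_measurable M f"
  shows "strongly_measurable M g"
proof -
  from assms(2) obtain s where "\<forall>i::nat. simple_function M (s i)"
    and lim: "AE x in M. (\<lambda>i. s i x) \<longlonglongrightarrow> f x"
    unfolding strongly_measurable_def by blast
  moreover have "AE x in M. (\<lambda>i. s i x) \<longlonglongrightarrow> g x"
    using assms(1) lim by eventually_elim simp
  ultimately show ?thesis
    unfolding strongly_measurable_def by blast
qed

lemma (in complete_measure) measurable_cong_AE_complete:
  assumes "AE x in M. f x = g x" and "f \<in> borel_measurable M"
  shows "g \<in> borel_measurable M"
proof (rule measurableI)
  fix B :: "'b set" assume "B \<in> sets borel"
  then have "f -` B \<inter> space M \<in> sets M"
    using assms(2) by (rule measurable_sets[rotated])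
  moreover have "AE x in M. x \<in> f -` B \<inter> space M \<longleftrightarrow> x \<in> g -` B \<inter> space M"
    using assms(1) by eventually_elim simp
  ultimately show "g -` B \<inter> space M \<in> sets M"
    by (metis in_sets_AE inf_le2)
qed simp

lemma (in complete_measure) esssup_cong_AE_complete:
  assumes "AE x in M. f x = g x"
  shows "esssup M f = esssup M g"
proof -
  have sym: "AE x in M. g x = f x"
    using assms by eventually_elim simp
  have "f \<in> borel_measurable M \<longleftrightarrow> g \<in> borel_measurable M"
    using measurable_cong_AE_complete assms sym by blast
  then show ?thesis
    using esssup_AE_cong[OF _ _ assms] by (cases "f \<in> borel_measurable M") (auto simp: esssup_def)
qed

context complete_measure
begin

lemma Lp_cong_AE:
  assumes "AE x in M. f x = g x"
  shows "f \<in> Lp_functions M p \<longleftrightarrow> g \<in> Lp_functions M p"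
    and "Lp_seminorm M p f = Lp_seminorm M p g"
    and "Lp_class M p f = Lp_class M p g"
proof -
  have sym: "AE x in M. g x = f x"
    using assms by eventually_elim simp
  have 1: "strongly_measurable M f \<longleftrightarrow> strongly_measurable M g"
    using strongly_measurable_cong_AE assms sym by blast
  have "AE x in M. ennreal (norm (f x)) = ennreal (norm (g x))"
    using assms by eventually_elim simp
  from esssup_cong_AE_complete[OF this]
  have 2: "esssup M (\<lambda>x. ennreal (norm (f x))) = esssup M (\<lambda>x. ennreal (norm (g x)))" .
  have 3: "(\<integral>\<^sup>+x. ennreal (norm (f x) powr r) \<partial>M) = (\<integral>\<^sup>+x. ennreal (norm (g x) powr r) \<partial>M)" for r
    by (rule nn_integral_cong_AE) (use assms in \<open>eventually_elim, simp\<close>)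
  show *: "f \<in> Lp_functions M p \<longleftrightarrow> g \<in> Lp_functions M p"
    by (simp add: Lp_functions_def 1 2 3)
  show "Lp_seminorm M p f = Lp_seminorm M p g"
    by (simp add: Lp_seminorm_def 2 3)
  have "(AE x in M. f x = h x) \<longleftrightarrow> (AE x in M. g x = h x)" for h
  proof
    assume "AE x in M. f x = h x" with assms show "AE x in M. g x = h x"
      by eventually_elim simp
  next
    assume "AE x in M. g x = h x" with assms show "AE x in M. f x = h x"
      by eventually_elim simp
  qed
  then show "Lp_class M p f = Lp_class M p g"
    by (auto simp: Lp_class_def Lp_rel_def *)
qed

lemma vnorm_Lp_class:
  assumes "f \<in> Lp_functions M p"
  shows "vnorm (Lp M p) (Lp_class M p f) = Lp_seminorm M p f"
  unfolding Lp_def using Lp_cong_AE(2)[OF Lp_rep_class(2)[OF assms]] by simp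

lemma vadd_Lp_class:
  assumes "f \<in> Lp_functions M p" and "g \<in> Lp_functions M p"
  shows "vadd (Lp M p) (Lp_class M p f) (Lp_class M p g) = Lp_class M p (\<lambda>x. f x + g x)"
  unfolding Lp_def using Lp_rep_class(2)[OF assms(1)] Lp_rep_class(2)[OF assms(2)]
  by (auto intro!: Lp_cong_AE(3))

lemma vscale_Lp_class:
  assumes "f \<in> Lp_functions M p"
  shows "vscale (Lp M p) c (Lp_class M p f) = Lp_class M p (\<lambda>x. c *\<^sub>R f x)"
  unfolding Lp_def using Lp_rep_class(2)[OF assms] by (auto intro!: Lp_cong_AE(3))

end

lemma complete_measure_lebesgue_on:
  assumes "S \<in> sets lebesgue"
  shows "complete_measure (lebesgue_on S)"
proof
  fix A B :: "'a set" assume "B \<subseteq> A" and "A \<in> null_sets (lebesgue_on S)"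
  with assms have "A \<in> null_sets lebesgue" and "A \<subseteq> S"
    by (auto simp: null_sets_restrict_space)
  with \<open>B \<subseteq> A\<close> have "B \<in> null_sets lebesgue" and "B \<subseteq> S"
    using null_sets_completion_subset by blast+
  then show "B \<in> sets (lebesgue_on S)"
    using assms by (auto simp: sets_restrict_space_iff)
qed

lemma Bochner_integral_cong_AE:
  assumes "AE x in M. f x = g x"
  shows "Bochner_integral M f = Bochner_integral M g"
proof -
  have sym: "AE x in M. g x = f x"
    using assms by eventually_elim simp
  have "strongly_measurable M f \<longleftrightarrow> strongly_measurable M g"
    using strongly_measurable_cong_AE assms sym by blast
  moreover have "(\<integral>\<^sup>+x. ennreal (norm (f x - h x)) \<partial>M) = (\<integral>\<^sup>+x. ennreal (norm (g x - h x)) \<partial>M)" for h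
    by (rule nn_integral_cong_AE) (use assms in \<open>eventually_elim, simp\<close>)
  ultimately have "has_Bochner_integral M f = has_Bochner_integral M g"
    by (simp add: has_Bochner_integral_def fun_eq_iff)
  then show ?thesis
    by (simp add: Bochner_integral_def)
qed

lemma RL_operator_class:
  assumes "f \<in> Lp_functions (lebesgue_on {t0..t1}) p"
  shows "RL_operator p t0 t1 \<alpha> (Lp_class (lebesgue_on {t0..t1}) p f) =
    Lp_class (lebesgue_on {t0..t1}) p (RL_integral t0 \<alpha> f)"
proof -
  interpret complete_measure "lebesgue_on {t0..t1}"
    by (rule complete_measure_lebesgue_on) simp
  let ?g = "Lp_rep (Lp_class (lebesgue_on {t0..t1}) p f)"
  have eq: "AE s in lebesgue_on {t0..t1}. ?g s = f s"
    by (rule Lp_rep_class(2)[OF assms])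
  have "RL_integral t0 \<alpha> ?g t = RL_integral t0 \<alpha> f t" if "\<alpha> \<noteq> 0" "t \<in> {t0..t1}" for t
  proof -
    have "AE s in lebesgue_on {t0..t}. ?g s = f s"
      using eq that(2) by (auto simp: AE_restrict_space_iff elim!: eventually_mono)
    then have "AE s in lebesgue_on {t0..t}.
        (t - s) powr (\<alpha> - 1) *\<^sub>R ?g s = (t - s) powr (\<alpha> - 1) *\<^sub>R f s"
      by eventually_elim simp
    from Bochner_integral_cong_AE[OF this] show ?thesis
      using that(1) by (simp add: RL_integral_def)
  qed
  then have "AE t in lebesgue_on {t0..t1}. RL_integral t0 \<alpha> ?g t = RL_integral t0 \<alpha> f t"
    using eq by (cases "\<alpha> = 0") (auto simp: RL_integral_def intro!: AE_I2)
  then show ?thesis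
    unfolding RL_operator_def by (rule Lp_cong_AE(3))
qed

end

theory Submission
  imports Defs
begin

text \<open>
  Fractional integration acts on powers by a scalar factor and a shift of the exponent: on
  \<open>(t - t0)^n x\<close>, the operator of order \<open>\<alpha>\<close> gives
  \<open>n! / \<Gamma> (n + 1 + \<alpha>) (t - t0)^(n + \<alpha>) x\<close>. Differentiating at \<open>\<alpha> = 0\<close> suggests that the
  generator multiplies this power by \<open>ln (t - t0) - \<psi> (n + 1)\<close>, where \<open>\<psi>\<close> is the digamma function.
  On the interval the logarithm is bounded above by \<open>ln (t1 - t0)\<close>, whereas
  \<open>\<psi> (n + 1) = H\<^sub>n - \<gamma>\<close> tends to infinity. So the multiplier is pointwise at least
  \<open>\<psi> (n + 1) - ln (t1 - t0)\<close> in absolute value (\<open>Lp_seminorm_monomial_le\<close>), and the generator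
  stretches the powers by arbitrarily large factors, in every \<open>L\<^sup>p\<close> norm at once.
  
  Two points need work. The powers must lie in the domain: for \<open>n \<ge> 2\<close> the difference quotients
  converge even uniformly on the interval (\<open>power_quotient_bound\<close>), which covers all \<open>p\<close> including
  \<open>\<infinity>\<close>. And the value of the generator, known only as some limit of these quotients, must be compared
  with the candidate limit; \<open>generator_limit_Lp_comparable\<close> does this up to the constant \<open>16\<close>, which
  is harmless because the stretching factors are unbounded.
  
  The explicit formula for the fractional integral of a power is the beta integral, transferred to
  vector values by \<open>Bochner_integral_scaleR_left\<close>.
\<close>

section \<open>Strongly measurable functions\<close>

lemma strongly_measurable_continuous_compose:
  assumes "strongly_measurable M f" and "continuous_on UNIV g"
  shows "strongly_measurable M (\<lambda>x. g (f x))"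
proof -
  from assms(1) obtain s where s: "\<forall>i::nat. simple_function M (s i)"
    and lim: "AE x in M. (\<lambda>i. s i x) \<longlonglongrightarrow> f x"
    unfolding strongly_measurable_def by blast
  have "\<forall>i. simple_function M (\<lambda>x. g (s i x))"
    using s by (auto intro: simple_function_compose1)
  moreover have "AE x in M. (\<lambda>i. g (s i x)) \<longlonglongrightarrow> g (f x)"
    using lim by eventually_elim (rule continuous_on_tendsto_compose[OF assms(2)], simp_all)
  ultimately show ?thesis
    unfolding strongly_measurable_def by (intro exI[of _ "\<lambda>i x. g (s i x)"]) blast
qed

lemma strongly_measurable_add:
  assumes "strongly_measurable M f" and "strongly_measurable M g"
  shows "strongly_measurable M (\<lambda>x. f x + g x)"
proof -
  from assms obtain s t where s: "\<forall>i::nat. simple_function M (s i)" "\<forall>i::nat. simple_function M (t i)"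
    and lim: "AE x in M. (\<lambda>i. s i x) \<longlonglongrightarrow> f x" "AE x in M. (\<lambda>i. t i x) \<longlonglongrightarrow> g x"
    unfolding strongly_measurable_def by blast
  have "\<forall>i. simple_function M (\<lambda>x. s i x + t i x)"
    using s by (auto intro: simple_function_compose2)
  moreover have "AE x in M. (\<lambda>i. s i x + t i x) \<longlonglongrightarrow> f x + g x"
    using lim by eventually_elim (rule tendsto_add)
  ultimately show ?thesis
    unfolding strongly_measurable_def by (intro exI[of _ "\<lambda>i x. s i x + t i x"]) blast
qed

lemma strongly_measurable_scaleR_left:
  fixes \<phi> :: "'s \<Rightarrow> real"
  assumes "\<phi> \<in> borel_measurable M"
  shows "strongly_measurable M (\<lambda>s. \<phi> s *\<^sub>R x)"
proof -
  obtain s where "\<forall>i::nat. simple_function M (s i)" "\<forall>x\<in>space M. (\<lambda>i. s i x) \<longlonglongrightarrow> \<phi> x"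
    using borel_measurable_implies_sequence_metric[OF assms, of 0] by blast
  then have "strongly_measurable M \<phi>"
    unfolding strongly_measurable_def by (intro exI[of _ s]) (auto intro: AE_I2)
  then show ?thesis
    by (rule strongly_measurable_continuous_compose) (intro continuous_intros)
qed

context complete_measure
begin

text \<open>
  A strongly measurable function is only an almost everywhere limit of simple functions, so that
  completeness of the measure is what makes its norm measurable.
\<close>

lemma strongly_measurable_norm:
  assumes "strongly_measurable M f"
  shows "(\<lambda>x. norm (f x)) \<in> borel_measurable M"
proof -
  from assms obtain s where s: "\<forall>i::nat. simple_function M (s i)"
    and lim: "AE x in M. (\<lambda>i. s i x) \<longlonglongrightarrow> f x"
    unfolding strongly_measurable_def by blast
  have [measurable]: "(\<lambda>x. norm (s i x)) \<in> borel_measurable M" for i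
    by (rule borel_measurable_simple_function, rule simple_function_compose1[where g = norm]) (simp add: s)
  have "AE x in M. lim (\<lambda>i. norm (s i x)) = norm (f x)"
    using lim by eventually_elim (auto intro!: limI tendsto_norm)
  then show ?thesis
    by (rule measurable_cong_AE_complete) measurable
qed

end

section \<open>Norm estimates in the Lebesgue spaces\<close>

context complete_measure
begin

text \<open>
  Both the upper estimate for the error of the difference quotients and the lower estimate for the
  generator are pointwise bounds, turned into norm bounds for all \<open>p\<close> simultaneously by this lemma.
\<close>

lemma Lp_dominated:
  fixes f :: "'a \<Rightarrow> 'b::real_normed_vector" and g :: "'a \<Rightarrow> 'c::real_normed_vector"
  assumes "1 \<le> p" and g: "g \<in> Lp_functions M p" and f: "strongly_measurable M f" and "0 \<le> c"
    and le: "AE x in M. norm (f x) \<le> c * norm (g x)"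
  shows "f \<in> Lp_functions M p" and "Lp_seminorm M p f \<le> c * Lp_seminorm M p g"
proof -
  have [measurable]: "(\<lambda>x. norm (f x)) \<in> borel_measurable M" "(\<lambda>x. norm (g x)) \<in> borel_measurable M"
    using f g by (auto intro: strongly_measurable_norm simp: Lp_functions_def)
  have "f \<in> Lp_functions M p \<and> Lp_seminorm M p f \<le> c * Lp_seminorm M p g"
  proof (cases "p = \<infinity>")
    case True
    let ?F = "esssup M (\<lambda>x. ennreal (norm (f x)))" and ?G = "esssup M (\<lambda>x. ennreal (norm (g x)))"
    have G: "?G < \<infinity>"
      using g True by (simp add: Lp_functions_def)
    have "AE x in M. ennreal (norm (f x)) \<le> ennreal c * ?G"
      using le esssup_AE[where M = M and f = "\<lambda>x. ennreal (norm (g x))"]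
    proof eventually_elim
      case (elim x)
      have "ennreal (norm (f x)) \<le> ennreal c * ennreal (norm (g x))"
        using elim(1) \<open>0 \<le> c\<close> by (simp add: ennreal_mult[symmetric] ennreal_leI)
      also have "\<dots> \<le> ennreal c * ?G"
        using elim(2) by (intro mult_left_mono) auto
      finally show ?case .
    qed
    then have *: "?F \<le> ennreal c * ?G"
      by (intro esssup_I) measurable
    also have fin: "ennreal c * ?G < \<infinity>"
      using G by (simp add: ennreal_mult_less_top)
    finally have "?F < \<infinity>" .
    moreover have "enn2real ?F \<le> c * enn2real ?G"
      using enn2real_mono[OF *] fin \<open>0 \<le> c\<close> by (simp add: enn2real_mult)
    ultimately show ?thesis
      using True f by (simp add: Lp_functions_def Lp_seminorm_def)
  next
    case False
    define r where "r = enn2real p"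
    have r: "1 \<le> r"
      using enn2real_mono[OF \<open>1 \<le> p\<close>] False by (simp add: r_def less_top)
    let ?F = "\<integral>\<^sup>+x. ennreal (norm (f x) powr r) \<partial>M" and ?G = "\<integral>\<^sup>+x. ennreal (norm (g x) powr r) \<partial>M"
    have G: "?G < \<infinity>"
      using g False by (simp add: Lp_functions_def r_def)
    have "?F \<le> (\<integral>\<^sup>+x. ennreal (c powr r) * ennreal (norm (g x) powr r) \<partial>M)"
    proof (rule nn_integral_mono_AE)
      show "AE x in M. ennreal (norm (f x) powr r) \<le> ennreal (c powr r) * ennreal (norm (g x) powr r)"
        using le
      proof eventually_elim
        case (elim x)
        have "norm (f x) powr r \<le> (c * norm (g x)) powr r"
          using elim r by (intro powr_mono2) auto
        then show ?case
          using \<open>0 \<le> c\<close> by (simp add: powr_mult ennreal_mult[symmetric] ennreal_leI)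
      qed
    qed
    also have "\<dots> = ennreal (c powr r) * ?G"
      by (intro nn_integral_cmult) measurable
    finally have *: "?F \<le> ennreal (c powr r) * ?G" .
    also have fin: "\<dots> < \<infinity>"
      using G by (simp add: ennreal_mult_less_top)
    finally have "?F < \<infinity>" .
    moreover have "enn2real ?F \<le> c powr r * enn2real ?G"
      using enn2real_mono[OF *] fin by (simp add: enn2real_mult)
    then have "enn2real ?F powr (1/r) \<le> (c powr r * enn2real ?G) powr (1/r)"
      using r by (intro powr_mono2) auto
    then have "enn2real ?F powr (1/r) \<le> c * enn2real ?G powr (1/r)"
      using r \<open>0 \<le> c\<close> by (simp add: powr_mult powr_powr)
    ultimately show ?thesis
      using False f by (simp add: Lp_functions_def Lp_seminorm_def r_def)
  qed
  then show "f \<in> Lp_functions M p" and "Lp_seminorm M p f \<le> c * Lp_seminorm M p g"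
    by auto
qed

text \<open>
  The Minkowski inequality up to a constant. The loss makes the proof elementary for finite \<open>p = r\<close>:
  pointwise, \<open>(a + b)^r \<le> 2^r (a^r + b^r)\<close> because the sum is at most twice the maximum, and after
  integration \<open>2 \<le> 2^r\<close> absorbs the sum of the two integrals into their maximum.
\<close>

lemma Lp_quasi_triangle:
  fixes f :: "'a \<Rightarrow> 'b::real_normed_vector" and g h :: "'a \<Rightarrow> 'c::real_normed_vector"
  assumes "1 \<le> p" and g: "g \<in> Lp_functions M p" and h: "h \<in> Lp_functions M p"
    and f: "strongly_measurable M f"
    and le: "AE x in M. norm (f x) \<le> norm (g x) + norm (h x)"
  shows "f \<in> Lp_functions M p"
    and "Lp_seminorm M p f \<le> 4 * (Lp_seminorm M p g + Lp_seminorm M p h)"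
proof -
  have [measurable]: "(\<lambda>x. norm (f x)) \<in> borel_measurable M" "(\<lambda>x. norm (g x)) \<in> borel_measurable M"
     "(\<lambda>x. norm (h x)) \<in> borel_measurable M"
    using f g h by (auto intro: strongly_measurable_norm simp: Lp_functions_def)
  have "f \<in> Lp_functions M p \<and> Lp_seminorm M p f \<le> 4 * (Lp_seminorm M p g + Lp_seminorm M p h)"
  proof (cases "p = \<infinity>")
    case True
    let ?F = "esssup M (\<lambda>x. ennreal (norm (f x)))" and ?G = "esssup M (\<lambda>x. ennreal (norm (g x)))"
      and ?H = "esssup M (\<lambda>x. ennreal (norm (h x)))"
    have fin: "?G < \<infinity>" "?H < \<infinity>"
      using g h True by (auto simp add: Lp_functions_def)
    have "AE x in M. ennreal (norm (f x)) \<le> ?G + ?H"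
      using le esssup_AE[where M = M and f = "\<lambda>x. ennreal (norm (g x))"]
        esssup_AE[where M = M and f = "\<lambda>x. ennreal (norm (h x))"]
    proof eventually_elim
      case (elim x)
      have "ennreal (norm (f x)) \<le> ennreal (norm (g x)) + ennreal (norm (h x))"
        using elim(1) by (simp add: ennreal_plus[symmetric] ennreal_leI del: ennreal_plus)
      also have "\<dots> \<le> ?G + ?H"
        using elim(2,3) by (intro add_mono)
      finally show ?case .
    qed
    then have *: "?F \<le> ?G + ?H"
      by (intro esssup_I) measurable
    also have "?G + ?H < \<infinity>"
      using fin by simp
    finally have "?F < \<infinity>" .
    moreover have "enn2real ?F \<le> enn2real ?G + enn2real ?H"
      using enn2real_mono[OF *] fin by (simp add: enn2real_plus)
    then have "enn2real ?F \<le> 4 * (enn2real ?G + enn2real ?H)"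
      by (rule order_trans) (auto intro: add_nonneg_nonneg)
    ultimately show ?thesis
      using True f by (simp add: Lp_functions_def Lp_seminorm_def)
  next
    case False
    define r where "r = enn2real p"
    have r: "1 \<le> r"
      using enn2real_mono[OF \<open>1 \<le> p\<close>] False by (simp add: r_def less_top)
    let ?F = "\<integral>\<^sup>+x. ennreal (norm (f x) powr r) \<partial>M" and ?G = "\<integral>\<^sup>+x. ennreal (norm (g x) powr r) \<partial>M"
     and ?H = "\<integral>\<^sup>+x. ennreal (norm (h x) powr r) \<partial>M"
    have fin: "?G < \<infinity>" "?H < \<infinity>"
      using g h False by (auto simp add: Lp_functions_def r_def)
    have "?F \<le> (\<integral>\<^sup>+x. ennreal (2 powr r) * (ennreal (norm (g x) powr r) + ennreal (norm (h x) powr r)) \<partial>M)"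
    proof (rule nn_integral_mono_AE)
      show "AE x in M. ennreal (norm (f x) powr r)
          \<le> ennreal (2 powr r) * (ennreal (norm (g x) powr r) + ennreal (norm (h x) powr r))"
        using le
      proof eventually_elim
        case (elim x)
        have "norm (f x) powr r \<le> (2 * max (norm (g x)) (norm (h x))) powr r"
          using elim r by (intro powr_mono2) auto
        also have "\<dots> = 2 powr r * max (norm (g x)) (norm (h x)) powr r"
          by (simp add: powr_mult le_max_iff_disj)
        also have "\<dots> \<le> 2 powr r * (norm (g x) powr r + norm (h x) powr r)"
          by (intro mult_left_mono) (auto simp: max_def)
        finally show ?case
          by (simp add: ennreal_mult[symmetric] ennreal_plus[symmetric] ennreal_leI del: ennreal_plus)
      qed
    qed
    also have "\<dots> = ennreal (2 powr r) * (?G + ?H)"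
      by (simp add: nn_integral_cmult nn_integral_add)
    finally have *: "?F \<le> ennreal (2 powr r) * (?G + ?H)" .
    also have fin2: "\<dots> < \<infinity>"
      using fin by (simp add: ennreal_mult_less_top)
    finally have "?F < \<infinity>" .
    define a where "a = max (enn2real ?G powr (1/r)) (enn2real ?H powr (1/r))"
    have "0 \<le> a"
      by (simp add: a_def le_max_iff_disj)
    have le_a: "v \<le> a powr r" if "0 \<le> v" "v powr (1/r) \<le> a" for v
      using powr_mono2[OF _ _ that(2), of r] r that(1) by (simp add: powr_powr)
    have "enn2real ?G \<le> a powr r" "enn2real ?H \<le> a powr r"
      by (rule le_a, simp, simp add: a_def)+
    moreover have "enn2real ?F \<le> 2 powr r * (enn2real ?G + enn2real ?H)"
      using enn2real_mono[OF *] fin fin2 by (simp add: enn2real_mult enn2real_plus)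
    ultimately have "enn2real ?F \<le> 2 powr r * (2 * a powr r)"
      by (smt (verit) mult_left_mono powr_ge_zero)
    also have "\<dots> \<le> 2 powr r * (2 powr r * a powr r)"
      using powr_mono[OF r, of 2] by (intro mult_left_mono mult_right_mono) auto
    also have "\<dots> = (4 * a) powr r"
      using \<open>0 \<le> a\<close> by (simp add: powr_mult[symmetric])
    finally have "enn2real ?F powr (1/r) \<le> ((4 * a) powr r) powr (1/r)"
      using r by (intro powr_mono2) auto
    then have "enn2real ?F powr (1/r) \<le> 4 * a"
      using r \<open>0 \<le> a\<close> by (simp add: powr_powr)
    also have "a \<le> enn2real ?G powr (1/r) + enn2real ?H powr (1/r)"
      by (simp add: a_def)
    finally have "enn2real ?F powr (1/r) \<le> 4 * (enn2real ?G powr (1/r) + enn2real ?H powr (1/r))"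
      by simp
    with \<open>?F < \<infinity>\<close> show ?thesis
      using False f by (simp add: Lp_functions_def Lp_seminorm_def r_def)
  qed
  then show "f \<in> Lp_functions M p"
    and "Lp_seminorm M p f \<le> 4 * (Lp_seminorm M p g + Lp_seminorm M p h)"
    by auto
qed

lemma Lp_functions_add:
  assumes "1 \<le> p" and "f \<in> Lp_functions M p" and "g \<in> Lp_functions M p"
  shows "(\<lambda>x. f x + g x) \<in> Lp_functions M p"
proof (rule Lp_quasi_triangle(1)[OF assms])
  show "strongly_measurable M (\<lambda>x. f x + g x)"
    using assms(2,3) by (intro strongly_measurable_add) (simp_all add: Lp_functions_def)
qed (simp add: norm_triangle_ineq)

lemma Lp_functions_scaleR:
  assumes "1 \<le> p" and "f \<in> Lp_functions M p"
  shows "(\<lambda>x. c *\<^sub>R f x) \<in> Lp_functions M p"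
proof (rule Lp_dominated(1)[OF assms, where c = "\<bar>c\<bar>"])
  have "strongly_measurable M f"
    using assms(2) by (simp add: Lp_functions_def)
  then show "strongly_measurable M (\<lambda>x. c *\<^sub>R f x)"
    by (rule strongly_measurable_continuous_compose[where g = "\<lambda>y. c *\<^sub>R y"])
       (intro continuous_intros)
qed simp_all

lemma Lp_functions_diff:
  assumes "1 \<le> p" and "f \<in> Lp_functions M p" and "g \<in> Lp_functions M p"
  shows "(\<lambda>x. f x - g x) \<in> Lp_functions M p"
  using Lp_functions_add[OF assms(1,2) Lp_functions_scaleR[OF assms(1,3), of "-1"]] by simp

lemma Lp_seminorm_eq_0_imp_AE:
  fixes f :: "'a \<Rightarrow> 'b::real_normed_vector"
  assumes "1 \<le> p" and f: "f \<in> Lp_functions M p" and 0: "Lp_seminorm M p f = 0"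
  shows "AE x in M. f x = 0"
proof (cases "p = \<infinity>")
  case True
  then have "esssup M (\<lambda>x. ennreal (norm (f x))) = 0"
    using f 0 by (auto simp: Lp_functions_def Lp_seminorm_def enn2real_eq_0_iff)
  then show ?thesis
    using esssup_AE[where M = M and f = "\<lambda>x. ennreal (norm (f x))"] by simp
next
  case False
  have [measurable]: "(\<lambda>x. norm (f x)) \<in> borel_measurable M"
    using f by (intro strongly_measurable_norm) (simp add: Lp_functions_def)
  have "(\<integral>\<^sup>+x. ennreal (norm (f x) powr enn2real p) \<partial>M) = 0"
    using f 0 False by (auto simp: Lp_functions_def Lp_seminorm_def enn2real_eq_0_iff)
  then show ?thesis
    by (subst (asm) nn_integral_0_iff_AE) auto
qed

end

lemma Lp_functions_const:
  fixes x :: "'b::real_normed_vector"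
  assumes "finite_measure M"
  shows "(\<lambda>_. x) \<in> Lp_functions M p"
proof -
  interpret finite_measure M
    by fact
  have "strongly_measurable M (\<lambda>_. x)"
    unfolding strongly_measurable_def by (intro exI[of _ "\<lambda>_ _. x"]) simp
  moreover have "esssup M (\<lambda>_. ennreal (norm x)) < \<infinity>"
    by (rule le_less_trans[OF esssup_I[where c = "ennreal (norm x)"]]) auto
  ultimately show ?thesis
    by (simp add: Lp_functions_def ennreal_mult_eq_top_iff less_top[symmetric])
qed

lemma Lp_bounded_scaleR_left:
  fixes \<phi> :: "'s \<Rightarrow> real" and x :: "'b::real_normed_vector"
  assumes "complete_measure M" and "finite_measure M" and "1 \<le> p"
    and "\<phi> \<in> borel_measurable M" and "0 \<le> C" and le: "AE s in M. \<bar>\<phi> s\<bar> \<le> C"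
  shows "(\<lambda>s. \<phi> s *\<^sub>R x) \<in> Lp_functions M p"
    and "Lp_seminorm M p (\<lambda>s. \<phi> s *\<^sub>R x) \<le> C * Lp_seminorm M p (\<lambda>_. x)"
proof -
  interpret complete_measure M
    by fact
  have "AE s in M. norm (\<phi> s *\<^sub>R x) \<le> C * norm x"
    using le by eventually_elim (simp add: mult_right_mono)
  note * = Lp_dominated[OF \<open>1 \<le> p\<close> Lp_functions_const[OF assms(2)]
      strongly_measurable_scaleR_left[OF assms(4)] \<open>0 \<le> C\<close> this]
  show "(\<lambda>s. \<phi> s *\<^sub>R x) \<in> Lp_functions M p"
    and "Lp_seminorm M p (\<lambda>s. \<phi> s *\<^sub>R x) \<le> C * Lp_seminorm M p (\<lambda>_. x)"
    by (rule *)+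
qed

section \<open>Limits of difference quotients\<close>

context complete_measure
begin

lemma vdiff_Lp_class:
  assumes "1 \<le> p" and "f \<in> Lp_functions M p" and "g \<in> Lp_functions M p"
  shows "vdiff (Lp M p) (Lp_class M p f) (Lp_class M p g) = Lp_class M p (\<lambda>x. f x - g x)"
  using assms vadd_Lp_class[OF assms(2) Lp_functions_scaleR[OF assms(1,3), of "-1"]]
  by (simp add: vdiff_def vscale_Lp_class)

lemma vcarrier_LpE:
  assumes "F \<in> vcarrier (Lp M p)"
  obtains f where "f \<in> Lp_functions M p" and "F = Lp_class M p f"
  using assms by (auto simp: Lp_def Lp_class_def elim: quotientE)

lemma Lp_class_in_vcarrier:
  "f \<in> Lp_functions M p \<Longrightarrow> Lp_class M p f \<in> vcarrier (Lp M p)"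
  by (auto simp: Lp_def Lp_class_def intro: quotientI)

lemma vnorm_quotient_diff:
  assumes "1 \<le> p" and "f \<in> Lp_functions M p" and "g \<in> Lp_functions M p" and "h \<in> Lp_functions M p"
  shows "vnorm (Lp M p) (vdiff (Lp M p)
      (vscale (Lp M p) c (vdiff (Lp M p) (Lp_class M p g) (Lp_class M p f))) (Lp_class M p h)) =
    Lp_seminorm M p (\<lambda>x. c *\<^sub>R (g x - f x) - h x)"
  using assms
  by (simp add: vdiff_Lp_class vscale_Lp_class vnorm_Lp_class Lp_functions_diff Lp_functions_scaleR)

text \<open>
  Any two limits of the same difference quotients \<open>q\<close> have comparable norms: the quasi-triangle
  inequality is used once to pass from the first limit to \<open>q\<close> and once from \<open>q\<close> to the second limit,
  whence \<open>16 = 4 * 4\<close>. This stands in for uniqueness of limits.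
\<close>

lemma generator_limit_Lp_comparable:
  assumes "1 \<le> p" and y: "y \<in> vcarrier (Lp M p)"
    and T: "\<And>\<alpha>. 0 < \<alpha> \<Longrightarrow> T \<alpha> y \<in> vcarrier (Lp M p)"
    and z: "generator_limit (Lp M p) T y z" and z': "generator_limit (Lp M p) T y z'"
  shows "vnorm (Lp M p) z \<le> 16 * vnorm (Lp M p) z'"
proof -
  let ?n = "Lp_seminorm M p"
  obtain f where f: "f \<in> Lp_functions M p" "y = Lp_class M p f"
    using y by (rule vcarrier_LpE)
  obtain h where h: "h \<in> Lp_functions M p" "z = Lp_class M p h"
    using z by (auto simp: generator_limit_def elim: vcarrier_LpE)
  obtain h' where h': "h' \<in> Lp_functions M p" "z' = Lp_class M p h'"
    using z' by (auto simp: generator_limit_def elim: vcarrier_LpE)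
  have "\<exists>g. g \<in> Lp_functions M p \<and> T \<alpha> y = Lp_class M p g" if "0 < \<alpha>" for \<alpha>
    using T[OF that] by (auto elim: vcarrier_LpE)
  then obtain g where g: "\<And>\<alpha>. 0 < \<alpha> \<Longrightarrow> g \<alpha> \<in> Lp_functions M p"
      "\<And>\<alpha>. 0 < \<alpha> \<Longrightarrow> T \<alpha> y = Lp_class M p (g \<alpha>)"
    by metis
  define q where "q \<alpha> x = (1 / \<alpha>) *\<^sub>R (g \<alpha> x - f x)" for \<alpha> x
  have q: "q \<alpha> \<in> Lp_functions M p" if "0 < \<alpha>" for \<alpha>
    unfolding q_def using assms(1) f g[OF that] by (intro Lp_functions_scaleR Lp_functions_diff)
  define e where "e \<alpha> = ?n (\<lambda>x. q \<alpha> x - h x)" for \<alpha>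
  define e' where "e' \<alpha> = ?n (\<lambda>x. q \<alpha> x - h' x)" for \<alpha>
  have pos: "eventually (\<lambda>\<alpha>::real. 0 < \<alpha>) (at_right 0)"
    by (simp add: eventually_at_right_less)
  let ?d = "\<lambda>\<alpha> z. vnorm (Lp M p) (vdiff (Lp M p)
      (vscale (Lp M p) (1 / \<alpha>) (vdiff (Lp M p) (T \<alpha> y) y)) z)"
  have "eventually (\<lambda>\<alpha>. ?d \<alpha> z = e \<alpha>) (at_right 0)"
    using pos
  proof eventually_elim
    case (elim \<alpha>)
    show ?case
      unfolding g(2)[OF elim] unfolding f(2) h(2) e_def q_def
      by (rule vnorm_quotient_diff[OF assms(1) f(1) g(1)[OF elim] h(1)])
  qed
  then have e: "(e \<longlongrightarrow> 0) (at_right 0)"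
    using z unfolding generator_limit_def by (blast intro: Lim_transform_eventually)
  have "eventually (\<lambda>\<alpha>. ?d \<alpha> z' = e' \<alpha>) (at_right 0)"
    using pos
  proof eventually_elim
    case (elim \<alpha>)
    show ?case
      unfolding g(2)[OF elim] unfolding f(2) h'(2) e'_def q_def
      by (rule vnorm_quotient_diff[OF assms(1) f(1) g(1)[OF elim] h'(1)])
  qed
  then have e': "(e' \<longlongrightarrow> 0) (at_right 0)"
    using z' unfolding generator_limit_def by (blast intro: Lim_transform_eventually)
  have "?n h \<le> 4 * (e \<alpha> + 4 * (e' \<alpha> + ?n h'))" if "0 < \<alpha>" for \<alpha>
  proof -
    note L = q[OF that] h(1) h'(1)
    have "?n h \<le> 4 * (e \<alpha> + ?n (q \<alpha>))"
      unfolding e_def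
      using L norm_triangle_sub[of "h x" "q \<alpha> x" for x]
      by (intro Lp_quasi_triangle(2) assms(1) Lp_functions_diff)
         (auto simp: Lp_functions_def norm_minus_commute add.commute)
    moreover have "?n (q \<alpha>) \<le> 4 * (e' \<alpha> + ?n h')"
      unfolding e'_def
      using L norm_triangle_sub[of "q \<alpha> x" "h' x" for x]
      by (intro Lp_quasi_triangle(2) assms(1) Lp_functions_diff)
         (auto simp: Lp_functions_def add.commute)
    ultimately show ?thesis
      by simp
  qed
  then have "eventually (\<lambda>\<alpha>. ?n h \<le> 4 * (e \<alpha> + 4 * (e' \<alpha> + ?n h'))) (at_right 0)"
    using pos by (auto elim: eventually_mono)
  moreover have "((\<lambda>\<alpha>. 4 * (e \<alpha> + 4 * (e' \<alpha> + ?n h'))) \<longlongrightarrow> 4 * (0 + 4 * (0 + ?n h'))) (at_right 0)"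
    by (intro tendsto_intros e e')
  ultimately have "?n h \<le> 4 * (0 + 4 * (0 + ?n h'))"
    by (intro tendsto_lowerbound) auto
  then show ?thesis
    using h h' by (simp add: vnorm_Lp_class)
qed

end

section \<open>The Bochner integral of a scalar function times a vector\<close>

text \<open>
  In a nonseparable space sums and differences of Borel functions need not be measurable; if one of
  them is simple, the difference is pieced together from finitely many translates of the other.
\<close>

lemma borel_measurable_norm_diff_simple:
  fixes f :: "'s \<Rightarrow> 'b::real_normed_vector"
  assumes [measurable]: "f \<in> borel_measurable M" and s: "simple_function M s"
  shows "(\<lambda>x. norm (f x - s x)) \<in> borel_measurable M"
proof (rule measurable_compose_countable'[where f = "\<lambda>y x. norm (f x - y)" and g = s and I = "s ` space M"])
  show "s \<in> measurable M (count_space (s ` space M))"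
    using s by (auto simp: simple_function_def intro!: measurable_count_space_eq2[THEN iffD2])
  show "countable (s ` space M)"
    using s by (simp add: simple_functionD(1) countable_finite)
  show "(\<lambda>x. norm (f x - y)) \<in> borel_measurable M" for y
    by (rule measurable_compose[OF assms(1)], rule borel_measurable_continuous_onI)
       (intro continuous_intros)
qed

text \<open>
  Two approximating sequences of simple functions have integrals that differ by at most the sum of
  their \<open>L\<^sup>1\<close> distances to the function.
\<close>

lemma has_Bochner_integral_unique:
  fixes f :: "'s \<Rightarrow> 'b::real_normed_vector"
  assumes f: "f \<in> borel_measurable M"
    and "has_Bochner_integral M f I" and "has_Bochner_integral M f J"
  shows "I = J"
proof -
  from assms(2) obtain s where s: "\<And>i. Bochner_Integration.simple_bochner_integrable M (s i)"
    and s0: "(\<lambda>i. \<integral>\<^sup>+x. ennreal (norm (f x - s i x)) \<partial>M) \<longlonglongrightarrow> 0"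
    and sI: "(\<lambda>i. Bochner_Integration.simple_bochner_integral M (s i)) \<longlonglongrightarrow> I"
    unfolding has_Bochner_integral_def by blast
  from assms(3) obtain t where t: "\<And>i. Bochner_Integration.simple_bochner_integrable M (t i)"
    and t0: "(\<lambda>i. \<integral>\<^sup>+x. ennreal (norm (f x - t i x)) \<partial>M) \<longlonglongrightarrow> 0"
    and tJ: "(\<lambda>i. Bochner_Integration.simple_bochner_integral M (t i)) \<longlonglongrightarrow> J"
    unfolding has_Bochner_integral_def by blast
  have [measurable]: "(\<lambda>x. norm (f x - s i x)) \<in> borel_measurable M"
    "(\<lambda>x. norm (f x - t i x)) \<in> borel_measurable M" for i
    using s t by (auto intro!: borel_measurable_norm_diff_simple[OF f] elim: simple_bochner_integrable.cases)
  have le: "ennreal (norm (Bochner_Integration.simple_bochner_integral M (s i) - Bochner_Integration.simple_bochner_integral M (t i))) \<le>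
      (\<integral>\<^sup>+x. ennreal (norm (f x - s i x)) \<partial>M) + (\<integral>\<^sup>+x. ennreal (norm (f x - t i x)) \<partial>M)" for i
  proof -
    have "ennreal (norm (Bochner_Integration.simple_bochner_integral M (s i) - Bochner_Integration.simple_bochner_integral M (t i)))
        = norm (Bochner_Integration.simple_bochner_integral M (\<lambda>x. s i x - t i x))"
      using s t by (subst simple_bochner_integral_diff) auto
    also have "\<dots> \<le> Bochner_Integration.simple_bochner_integral M (\<lambda>x. norm (s i x - t i x))"
      using simple_bochner_integrable_compose2[of "(-)" M "s i" "t i"] s t
      by (auto intro!: simple_bochner_integral_norm_bound)
    also have "\<dots> = (\<integral>\<^sup>+x. norm (s i x - t i x) \<partial>M)"
      using simple_bochner_integrable_compose2[of "\<lambda>x y. norm (x - y)" M "s i" "t i"] s t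
      by (auto intro!: simple_bochner_integral_eq_nn_integral)
    also have "\<dots> \<le> (\<integral>\<^sup>+x. ennreal (norm (f x - s i x)) + ennreal (norm (f x - t i x)) \<partial>M)"
    proof (rule nn_integral_mono)
      fix x
      have "norm (s i x - t i x) \<le> norm (f x - s i x) + norm (f x - t i x)"
        by (metis dual_order.refl norm_diff_triangle_le norm_minus_commute)
      then show "ennreal (norm (s i x - t i x)) \<le> ennreal (norm (f x - s i x)) + ennreal (norm (f x - t i x))"
        by (simp add: ennreal_plus[symmetric] ennreal_leI del: ennreal_plus)
    qed
    also have "\<dots> = (\<integral>\<^sup>+x. ennreal (norm (f x - s i x)) \<partial>M) + (\<integral>\<^sup>+x. ennreal (norm (f x - t i x)) \<partial>M)"
      by (rule nn_integral_add) measurable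
    finally show ?thesis .
  qed
  have "(\<lambda>i. ennreal (norm (Bochner_Integration.simple_bochner_integral M (s i) - Bochner_Integration.simple_bochner_integral M (t i)))) \<longlonglongrightarrow> 0"
    by (rule tendsto_sandwich[OF _ _ tendsto_const])
       (use le tendsto_add[OF s0 t0] in \<open>auto intro: always_eventually\<close>)
  then have "(\<lambda>i. Bochner_Integration.simple_bochner_integral M (s i) - Bochner_Integration.simple_bochner_integral M (t i)) \<longlonglongrightarrow> 0"
    by (auto simp: ennreal_0[symmetric] tendsto_norm_zero_iff simp del: ennreal_0)
  then show ?thesis
    using tendsto_diff[OF sI tJ] LIMSEQ_unique by fastforce
qed

lemma Bochner_integral_scaleR_left:
  fixes \<phi> :: "'s \<Rightarrow> real" and x :: "'b::real_normed_vector"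
  assumes "integrable M \<phi>"
  shows "Bochner_integral M (\<lambda>s. \<phi> s *\<^sub>R x) = integral\<^sup>L M \<phi> *\<^sub>R x"
proof -
  have [measurable]: "\<phi> \<in> borel_measurable M"
    using assms by auto
  from has_bochner_integral_integrable[OF assms] obtain s
    where s: "\<And>i. Bochner_Integration.simple_bochner_integrable M (s i)"
    and s0: "(\<lambda>i. \<integral>\<^sup>+x. norm (\<phi> x - s i x) \<partial>M) \<longlonglongrightarrow> 0"
    and sI: "(\<lambda>i. Bochner_Integration.simple_bochner_integral M (s i)) \<longlonglongrightarrow> integral\<^sup>L M \<phi>"
    by (elim has_bochner_integral.cases) blast
  have [measurable]: "s i \<in> borel_measurable M" for i
    using s by (auto intro: borel_measurable_simple_function elim: simple_bochner_integrable.cases)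
  have "(\<integral>\<^sup>+y. ennreal (norm (\<phi> y *\<^sub>R x - s i y *\<^sub>R x)) \<partial>M)
      = (\<integral>\<^sup>+y. norm (\<phi> y - s i y) \<partial>M) * ennreal (norm x)" for i
    by (subst nn_integral_multc[symmetric])
       (auto simp: scaleR_diff_left[symmetric] ennreal_mult[symmetric])
  moreover have "(\<lambda>i. (\<integral>\<^sup>+y. norm (\<phi> y - s i y) \<partial>M) * ennreal (norm x)) \<longlonglongrightarrow> 0 * ennreal (norm x)"
    by (rule tendsto_mult_ennreal[OF s0 tendsto_const]) auto
  ultimately have "(\<lambda>i. \<integral>\<^sup>+y. ennreal (norm (\<phi> y *\<^sub>R x - s i y *\<^sub>R x)) \<partial>M) \<longlonglongrightarrow> 0"
    by simp
  moreover have "(\<lambda>i. Bochner_Integration.simple_bochner_integral M (\<lambda>y. s i y *\<^sub>R x)) \<longlonglongrightarrow> integral\<^sup>L M \<phi> *\<^sub>R x"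
    by (subst simple_bochner_integral_linear[OF _ s])
       (auto intro!: tendsto_intros sI linearI simp: scaleR_add_left)
  moreover have "\<forall>i. Bochner_Integration.simple_bochner_integrable M (\<lambda>y. s i y *\<^sub>R x)"
    by (intro allI simple_bochner_integrable_compose2[where p = "\<lambda>a b. a *\<^sub>R x", OF _ s s])
       simp
  moreover have "strongly_measurable M (\<lambda>s. \<phi> s *\<^sub>R x)"
    by (rule strongly_measurable_scaleR_left) fact
  ultimately have *: "has_Bochner_integral M (\<lambda>s. \<phi> s *\<^sub>R x) (integral\<^sup>L M \<phi> *\<^sub>R x)"
    unfolding has_Bochner_integral_def by (intro conjI exI[of _ "\<lambda>i y. s i y *\<^sub>R x"])
  have "(\<lambda>s. \<phi> s *\<^sub>R x) \<in> borel_measurable M"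
    by (rule measurable_compose[of \<phi> M borel], fact, rule borel_measurable_continuous_onI)
       (intro continuous_intros)
  from has_Bochner_integral_unique[OF this _ *]
  have "(THE I. has_Bochner_integral M (\<lambda>s. \<phi> s *\<^sub>R x) I) = integral\<^sup>L M \<phi> *\<^sub>R x"
    using * by (rule the_equality[rotated])
  then show ?thesis
    using * by (auto simp: Bochner_integral_def)
qed

section \<open>Fractional integrals of powers\<close>

text \<open>
  The affine substitution that maps \<open>{c..t}\<close> to the unit interval, reversing orientation, turns this
  into the Euler beta integral.
\<close>

lemma has_integral_beta_interval:
  fixes a b c t :: real
  assumes "0 < a" and "0 < b" and "c < t"
  shows "((\<lambda>s. (t - s) powr (a - 1) * (s - c) powr (b - 1)) has_integral
    Beta a b * (t - c) powr (a + b - 1)) {c..t}"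
proof -
  define w where "w = t - c"
  have w: "0 < w"
    using assms by (simp add: w_def)
  have "((\<lambda>s. s powr (a - 1) * (1 - s) powr (b - 1)) has_integral Beta a b) (cbox 0 1)"
    using has_integral_Beta_real[OF assms(1,2)] by simp
  from has_integral_affinity[OF this, of "-1/w" "t/w"] w
  have "((\<lambda>s. (-1/w * s + t/w) powr (a - 1) * (1 - (-1/w * s + t/w)) powr (b - 1)) has_integral
      w * Beta a b) ((\<lambda>s. - w * s + t) ` {0..1})"
    by (simp add: field_simps)
  also have "(\<lambda>s. - w * s + t) ` {0..1} = {c..t}"
    using w image_affinity_atLeastAtMost[of "-w" t 0 1] by (simp add: w_def)
  finally have "((\<lambda>s. (-1/w * s + t/w) powr (a - 1) * (1 - (-1/w * s + t/w)) powr (b - 1)) has_integral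
      w * Beta a b) {c..t}" .
  from has_integral_mult_right[OF this, of "w powr (a - 1) * w powr (b - 1)"]
  have "((\<lambda>s. (t - s) powr (a - 1) * (s - c) powr (b - 1)) has_integral
      w powr (a - 1) * w powr (b - 1) * (w * Beta a b)) {c..t}"
  proof (rule has_integral_eq[rotated])
    fix s assume s: "s \<in> {c..t}"
    have "t = w + c"
      by (simp add: w_def)
    then have "-1/w * s + t/w = (t - s) / w" "1 - (-1/w * s + t/w) = (s - c) / w"
      using w by (simp_all add: field_simps)
    then show "w powr (a - 1) * w powr (b - 1) *
        ((-1/w * s + t/w) powr (a - 1) * (1 - (-1/w * s + t/w)) powr (b - 1)) =
        (t - s) powr (a - 1) * (s - c) powr (b - 1)"
      using w s by (simp add: powr_divide)
  qed
  also have "w powr (a - 1) * w powr (b - 1) * (w * Beta a b) = Beta a b * w powr (a + b - 1)"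
    using w by (simp add: powr_diff powr_add field_simps)
  finally show ?thesis
    by (simp add: w_def)
qed

text \<open>
  The factor \<open>n! / \<Gamma> (n + 1 + \<alpha>)\<close>, written with the entire function \<open>1 / \<Gamma>\<close> so that it is
  visibly differentiable in \<open>\<alpha>\<close>.
\<close>

definition RL_power_factor :: "nat \<Rightarrow> real \<Rightarrow> real" where
  "RL_power_factor n \<alpha> = fact n * rGamma (real n + 1 + \<alpha>)"

lemma RL_integral_power:
  fixes x :: "'a::real_normed_vector"
  assumes "0 < \<alpha>" and "t0 < t"
  shows "RL_integral t0 \<alpha> (\<lambda>s. (s - t0) ^ n *\<^sub>R x) t =
    (RL_power_factor n \<alpha> * (t - t0) powr (real n + \<alpha>)) *\<^sub>R x"
proof -
  let ?\<phi> = "\<lambda>s. (t - s) powr (\<alpha> - 1) * (s - t0) ^ n"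
  let ?I = "Beta \<alpha> (real n + 1) * (t - t0) powr (\<alpha> + real n)"
  have "((\<lambda>s. (t - s) powr (\<alpha> - 1) * (s - t0) powr (real n + 1 - 1)) has_integral ?I) {t0..t}"
    using has_integral_beta_interval[of \<alpha> "real n + 1" t0 t] assms by (simp add: add.assoc)
  \<comment> \<open>For \<open>n = 0\<close>, \<open>0 powr 0 = 0\<close> differs from \<open>0 ^ 0 = 1\<close>, so the end point is left out meanwhile.\<close>
  then have "((\<lambda>s. (t - s) powr (\<alpha> - 1) * (s - t0) powr (real n + 1 - 1)) has_integral ?I) {t0<..<t}"
    by (simp add: has_integral_Icc_iff_Ioo)
  then have "(?\<phi> has_integral ?I) {t0<..<t}"
    by (rule has_integral_eq[rotated]) (simp add: powr_realpow)
  then have I: "(?\<phi> has_integral ?I) {t0..t}"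
    by (simp add: has_integral_Icc_iff_Ioo)
  then have int: "integrable (lebesgue_on {t0..t}) ?\<phi>"
    by (intro absolutely_integrable_imp_integrable nonnegative_absolutely_integrable_1)
       (auto simp: integrable_on_def)
  have "integral\<^sup>L (lebesgue_on {t0..t}) ?\<phi> = ?I"
    using lebesgue_integral_eq_integral[OF int] I by (simp add: integral_unique)
  with Bochner_integral_scaleR_left[OF int, of x]
  have "RL_integral t0 \<alpha> (\<lambda>s. (s - t0) ^ n *\<^sub>R x) t = (1 / Gamma \<alpha> * ?I) *\<^sub>R x"
    using assms by (simp add: RL_integral_def)
  also have "1 / Gamma \<alpha> * ?I = RL_power_factor n \<alpha> * (t - t0) powr (real n + \<alpha>)"
    using Gamma_fact[of n, where 'a = real] less_imp_neq[OF Gamma_real_pos[OF assms(1)]]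
    by (simp add: Beta_def RL_power_factor_def rGamma_inverse_Gamma field_simps)
  finally show ?thesis .
qed

lemma RL_power_factor_deriv:
  "(RL_power_factor n has_real_derivative - Digamma (real n + 1)) (at 0)"
proof -
  have "real n + 1 \<notin> \<int>\<^sub>\<le>\<^sub>0"
    by (auto elim!: nonpos_Ints_cases)
  then have "(RL_power_factor n has_real_derivative
      fact n * (- rGamma (real n + 1) * Digamma (real n + 1))) (at 0)"
    unfolding RL_power_factor_def
    by (auto intro!: derivative_eq_intros has_field_derivative_rGamma_no_nonpos_int[THEN DERIV_chain2])
  also have "fact n * (- rGamma (real n + 1) * Digamma (real n + 1)) = - Digamma (real n + 1)"
    using Gamma_fact[of n, where 'a = real] by (simp add: rGamma_inverse_Gamma add.commute)
  finally show ?thesis .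
qed

lemma RL_power_factor_error_tendsto_0:
  "((\<lambda>\<alpha>. \<bar>RL_power_factor n \<alpha>\<bar> * \<alpha> + \<bar>RL_power_factor n \<alpha> - 1\<bar> +
      \<bar>(RL_power_factor n \<alpha> - 1) / \<alpha> + Digamma (real n + 1)\<bar>) \<longlongrightarrow> 0) (at_right 0)"
proof -
  let ?c = "RL_power_factor n"
  have c0: "?c 0 = 1"
    using Gamma_fact[of n, where 'a = real]
    by (simp add: RL_power_factor_def rGamma_inverse_Gamma add.commute)
  have "(?c \<longlongrightarrow> ?c 0) (at 0)"
    using DERIV_isCont[OF RL_power_factor_deriv] by (simp add: isCont_def)
  then have c: "(?c \<longlongrightarrow> 1) (at_right 0)"
    by (simp add: c0 filterlim_at_split)
  have "((\<lambda>\<alpha>. (?c \<alpha> - 1) / \<alpha>) \<longlongrightarrow> - Digamma (real n + 1)) (at 0)"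
    using RL_power_factor_deriv[of n] by (simp add: DERIV_def c0)
  then have d: "((\<lambda>\<alpha>. (?c \<alpha> - 1) / \<alpha>) \<longlongrightarrow> - Digamma (real n + 1)) (at_right 0)"
    by (simp add: filterlim_at_split)
  have "((\<lambda>\<alpha>. \<bar>?c \<alpha>\<bar> * \<alpha> + \<bar>?c \<alpha> - 1\<bar> + \<bar>(?c \<alpha> - 1) / \<alpha> + Digamma (real n + 1)\<bar>)
      \<longlongrightarrow> \<bar>1\<bar> * 0 + \<bar>1 - 1\<bar> + \<bar>- Digamma (real n + 1) + Digamma (real n + 1)\<bar>) (at_right 0)"
    by (intro tendsto_intros c d)
  then show ?thesis
    by simp
qed

section \<open>Uniform convergence of the difference quotients\<close>

text \<open>
  The maximum with \<open>1\<close> keeps the bound free of \<open>exp \<bar>y\<bar>\<close>: for negative \<open>y\<close> the error is at most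
  \<open>y\<^sup>2\<close>, which matters since \<open>y = \<alpha> * ln u\<close> is unbounded below as \<open>u\<close> tends to \<open>0\<close>.
\<close>

lemma abs_exp_minus_one_minus_le:
  fixes y :: real
  shows "\<bar>exp y - 1 - y\<bar> \<le> y\<^sup>2 * max 1 (exp y)"
proof (cases "0 \<le> y")
  case True
  obtain t where t: "\<bar>t\<bar> \<le> \<bar>y\<bar>"
    and eq: "exp y = (\<Sum>m<2. y ^ m / fact m) + exp t / fact 2 * y ^ 2"
    using Maclaurin_exp_le[of y 2] by blast
  have "\<bar>exp y - 1 - y\<bar> = y\<^sup>2 * (exp t / 2)"
    using eq by (simp add: numeral_2_eq_2)
  also have "\<dots> \<le> y\<^sup>2 * max 1 (exp y)"
  proof (rule mult_left_mono)
    have "exp t \<le> exp y"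
      using t True by simp
    then show "exp t / 2 \<le> max 1 (exp y)"
      using exp_gt_zero[of t] by linarith
  qed simp
  finally show ?thesis .
next
  case False
  have "exp y * (1 - y) \<le> exp y * exp (- y)"
    using exp_ge_add_one_self[of "-y"] by (intro mult_left_mono) auto
  also have "\<dots> = 1"
    by (simp add: exp_minus)
  finally have "exp y \<le> 1 / (1 - y)"
    using False by (simp add: pos_le_divide_eq)
  also have "\<dots> = 1 + y + y\<^sup>2 / (1 - y)"
    using False by (simp add: field_simps power2_eq_square)
  also have "y\<^sup>2 / (1 - y) \<le> y\<^sup>2"
    using False divide_left_mono[of 1 "1 - y" "y\<^sup>2"] by simp
  finally have "exp y - 1 - y \<le> y\<^sup>2"
    by simp
  moreover have "0 \<le> exp y - 1 - y"
    using exp_ge_add_one_self[of y] by linarith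
  ultimately show ?thesis
    using False by simp
qed

lemma mult_abs_ln_le:
  fixes u w :: real
  assumes "0 < u" and "u \<le> w"
  shows "u * \<bar>ln u\<bar> \<le> 1 + w\<^sup>2"
proof -
  have "ln u \<le> u"
    using ln_le_minus_one[of u] assms by simp
  have "ln (inverse u) \<le> inverse u"
    using ln_le_minus_one[of "inverse u"] assms by simp
  then have "- ln u \<le> inverse u"
    using assms by (simp add: ln_inverse)
  have "u * u \<le> w\<^sup>2"
    using assms by (simp add: power2_eq_square mult_mono)
  show ?thesis
  proof (cases "0 \<le> ln u")
    case True
    then have "u * \<bar>ln u\<bar> \<le> u * u"
      using assms \<open>ln u \<le> u\<close> by simp
    then show ?thesis
      using \<open>u * u \<le> w\<^sup>2\<close> by simp
  next
    case False
    then have "u * \<bar>ln u\<bar> \<le> u * inverse u"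
      using assms \<open>- ln u \<le> inverse u\<close> by (intro mult_left_mono) auto
    then show ?thesis
      using assms by (simp add: add_increasing2)
  qed
qed

text \<open>
  Here \<open>c\<close> stands for the factor \<open>RL_power_factor n \<alpha>\<close> and \<open>\<psi>\<close> for its negative derivative
  at \<open>0\<close>. The error splits into three parts,
  \<open>c ((u powr \<alpha> - 1) / \<alpha> - ln u) u^n + (c - 1) ln u u^n + ((c - 1) / \<alpha> + \<psi>) u^n\<close>.
  The first is of second order in \<open>ln u\<close>, and the two spare powers of \<open>u\<close> granted by \<open>2 \<le> n\<close>
  tame \<open>(ln u)\<^sup>2\<close> near \<open>0\<close>; this gives a bound uniform in \<open>u\<close>.
\<close>

lemma power_quotient_bound:
  fixes u w c \<psi> \<alpha> :: real
  assumes "0 < \<alpha>" and "\<alpha> \<le> 1" and u: "0 < u" "u \<le> w" and "2 \<le> n"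
  shows "\<bar>(c * u powr (real n + \<alpha>) - u ^ n) / \<alpha> - (ln u - \<psi>) * u ^ n\<bar>
    \<le> (1 + w) ^ (n + 3) * (\<bar>c\<bar> * \<alpha> + \<bar>c - 1\<bar> + \<bar>(c - 1) / \<alpha> + \<psi>\<bar>)"
proof -
  define m where "m = 1 + w"
  have m: "1 \<le> m" "u \<le> m"
    using u by (simp_all add: m_def)
  obtain k where n: "n = k + 2"
    using \<open>2 \<le> n\<close> by (metis add.commute le_Suc_ex)
  have uk: "u ^ j \<le> m ^ j" for j
    using u m by (intro power_mono) auto
  have "1 + w\<^sup>2 \<le> m\<^sup>2"
    using u by (simp add: m_def power2_eq_square algebra_simps)
  then have L: "u * \<bar>ln u\<bar> \<le> m\<^sup>2"
    using mult_abs_ln_le[OF u] by simp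
  have L2: "u ^ n * (ln u)\<^sup>2 \<le> m ^ (n + 2)"
  proof -
    have "u ^ n * (ln u)\<^sup>2 = u ^ k * (u * \<bar>ln u\<bar>)\<^sup>2"
      by (simp add: n power2_eq_square)
    also have "\<dots> \<le> m ^ k * (m\<^sup>2)\<^sup>2"
      using u m L by (intro mult_mono power_mono) auto
    also have "\<dots> = m ^ (n + 2)"
      by (simp add: n power_add power4_eq_xxxx power2_eq_square)
    finally show ?thesis .
  qed
  have L1: "u ^ n * \<bar>ln u\<bar> \<le> m ^ (n + 1)"
  proof -
    have "u ^ n * \<bar>ln u\<bar> = u ^ (k + 1) * (u * \<bar>ln u\<bar>)"
      by (simp add: n)
    also have "\<dots> \<le> m ^ (k + 1) * m\<^sup>2"
      using u uk[of "k + 1"] L m by (intro mult_mono) auto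
    also have "\<dots> = m ^ (n + 1)"
      by (simp add: n power_add[symmetric] del: power_Suc)
    finally show ?thesis .
  qed
  let ?e = "(u powr \<alpha> - 1) / \<alpha> - ln u"
  have e: "\<bar>?e\<bar> \<le> \<alpha> * (ln u)\<^sup>2 * m"
  proof -
    have pw: "u powr \<alpha> = exp (\<alpha> * ln u)"
      using u by (simp add: powr_def)
    have "u powr \<alpha> \<le> m powr 1"
      using powr_mono2[of \<alpha> u m] powr_mono[of \<alpha> 1 m] assms m by simp
    then have mx: "max 1 (exp (\<alpha> * ln u)) \<le> m"
      using m by (simp add: pw)
    have "\<bar>?e\<bar> = \<bar>exp (\<alpha> * ln u) - 1 - \<alpha> * ln u\<bar> / \<alpha>"
      using \<open>0 < \<alpha>\<close> by (simp add: pw field_simps abs_divide[symmetric] del: abs_divide)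
    also have "\<dots> \<le> (\<alpha> * ln u)\<^sup>2 * m / \<alpha>"
      using abs_exp_minus_one_minus_le[of "\<alpha> * ln u"] mx \<open>0 < \<alpha>\<close>
      by (intro divide_right_mono order_trans[OF abs_exp_minus_one_minus_le] mult_left_mono) auto
    also have "\<dots> = \<alpha> * (ln u)\<^sup>2 * m"
      using \<open>0 < \<alpha>\<close> by (simp add: power2_eq_square)
    finally show ?thesis .
  qed
  have "(c * u powr (real n + \<alpha>) - u ^ n) / \<alpha> - (ln u - \<psi>) * u ^ n =
      c * (?e * u ^ n) + (c - 1) * (ln u * u ^ n) + ((c - 1) / \<alpha> + \<psi>) * u ^ n"
    using assms(1) u by (simp add: powr_add powr_realpow field_simps)
  also have "\<bar>\<dots>\<bar> \<le> \<bar>c * (?e * u ^ n)\<bar> + \<bar>(c - 1) * (ln u * u ^ n)\<bar> + \<bar>((c - 1) / \<alpha> + \<psi>) * u ^ n\<bar>"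
    by (rule order_trans[OF abs_triangle_ineq add_right_mono[OF abs_triangle_ineq]])
  also have "\<dots> \<le> \<bar>c\<bar> * (\<alpha> * m ^ (n + 3)) + \<bar>c - 1\<bar> * m ^ (n + 3) + \<bar>(c - 1) / \<alpha> + \<psi>\<bar> * m ^ (n + 3)"
  proof (intro add_mono)
    have "\<bar>?e\<bar> * u ^ n \<le> \<alpha> * (ln u)\<^sup>2 * m * u ^ n"
      using e u by (intro mult_right_mono) auto
    also have "\<dots> = \<alpha> * (m * (u ^ n * (ln u)\<^sup>2))"
      by simp
    also have "\<dots> \<le> \<alpha> * (m * m ^ (n + 2))"
      using L2 m \<open>0 < \<alpha>\<close> by (intro mult_left_mono) auto
    also have "m * m ^ (n + 2) = m ^ (n + 3)"
      by (simp add: power_add power3_eq_cube power2_eq_square)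
    finally show "\<bar>c * (?e * u ^ n)\<bar> \<le> \<bar>c\<bar> * (\<alpha> * m ^ (n + 3))"
      using u by (simp add: abs_mult mult_left_mono)
    have "\<bar>ln u\<bar> * u ^ n \<le> m ^ (n + 3)"
      using L1 power_increasing[of "n + 1" "n + 3" m] m by (simp add: mult.commute)
    then show "\<bar>(c - 1) * (ln u * u ^ n)\<bar> \<le> \<bar>c - 1\<bar> * m ^ (n + 3)"
      using u by (simp add: abs_mult mult_left_mono)
    have "u ^ n \<le> m ^ (n + 3)"
      using uk[of n] power_increasing[of n "n + 3" m] m by simp
    then show "\<bar>((c - 1) / \<alpha> + \<psi>) * u ^ n\<bar> \<le> \<bar>(c - 1) / \<alpha> + \<psi>\<bar> * m ^ (n + 3)"
      using u by (simp add: abs_mult mult_left_mono)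
  qed
  finally show ?thesis
    by (simp add: m_def algebra_simps)
qed

section \<open>The generator on powers\<close>

lemma AE_lebesgue_on_interval:
  fixes t0 t1 :: real
  shows "AE t in lebesgue_on {t0..t1}. t0 < t \<and> t \<le> t1"
proof -
  have "AE t in lebesgue. t \<noteq> t0"
    by (intro AE_completion AE_lborel_singleton)
  then show ?thesis
    by (auto simp: AE_restrict_space_iff elim: eventually_mono)
qed

lemma borel_measurable_lebesgue_on:
  "f \<in> borel_measurable borel \<Longrightarrow> f \<in> borel_measurable (lebesgue_on S)"
  by (intro measurable_restrict_space1 measurable_completion) simp

locale interval_Lp =
  fixes t0 t1 :: real and p :: ennreal and x :: "'a::real_normed_vector"
  assumes less: "t0 < t1" and p: "1 \<le> p"
begin

abbreviation "M \<equiv> lebesgue_on {t0..t1}"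

definition monomial :: "nat \<Rightarrow> real \<Rightarrow> 'a" where
  "monomial n t = (t - t0) ^ n *\<^sub>R x"

text \<open>
  The derivative in \<open>\<alpha>\<close> at \<open>0\<close> of
  \<open>(fact n / \<Gamma> (n + 1 + \<alpha>) * (t - t0) powr (n + \<alpha>)) *\<^sub>R x\<close>, hence the expected image of
  \<open>monomial n\<close> under the generator.
\<close>

definition log_monomial :: "nat \<Rightarrow> real \<Rightarrow> 'a" where
  "log_monomial n t = ((ln (t - t0) - Digamma (real n + 1)) * (t - t0) ^ n) *\<^sub>R x"

sublocale complete_measure M
  by (rule complete_measure_lebesgue_on) simp

sublocale finite_measure M
  by (rule finite_measure_lebesgue_on) simp

lemma bounded_in_Lp:
  assumes "\<phi> \<in> borel_measurable borel" and "\<And>t. t0 < t \<Longrightarrow> t \<le> t1 \<Longrightarrow> \<bar>\<phi> t\<bar> \<le> C"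
  shows "(\<lambda>t. \<phi> t *\<^sub>R x) \<in> Lp_functions M p"
    and "Lp_seminorm M p (\<lambda>t. \<phi> t *\<^sub>R x) \<le> C * Lp_seminorm M p (\<lambda>_. x)"
proof -
  have "0 \<le> C"
    using assms(2)[of t1] less by simp
  have "AE t in M. \<bar>\<phi> t\<bar> \<le> C"
    using AE_lebesgue_on_interval[of t0 t1] by eventually_elim (use assms(2) in blast)
  note * = Lp_bounded_scaleR_left[OF complete_measure_axioms finite_measure_axioms p
      borel_measurable_lebesgue_on[OF assms(1)] \<open>0 \<le> C\<close> this]
  show "(\<lambda>t. \<phi> t *\<^sub>R x) \<in> Lp_functions M p"
    and "Lp_seminorm M p (\<lambda>t. \<phi> t *\<^sub>R x) \<le> C * Lp_seminorm M p (\<lambda>_. x)"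
    by (rule *)+
qed

lemma monomial_in_Lp: "monomial n \<in> Lp_functions M p"
  unfolding monomial_def using less
  by (intro bounded_in_Lp(1)[where C = "(t1 - t0) ^ n"]) (auto simp: power_abs intro!: power_mono)

lemma log_monomial_in_Lp:
  assumes "1 \<le> n"
  shows "log_monomial n \<in> Lp_functions M p"
proof -
  obtain k where n: "n = k + 1"
    using assms by (metis add.commute le_Suc_ex)
  define w where "w = t1 - t0"
  show ?thesis
    unfolding log_monomial_def
  proof (rule bounded_in_Lp(1))
    fix t assume t: "t0 < t" "t \<le> t1"
    define u where "u = t - t0"
    have u: "0 < u" "u \<le> w"
      using t by (simp_all add: u_def w_def)
    have "\<bar>(ln u - Digamma (real n + 1)) * u ^ n\<bar> =
        \<bar>ln u - Digamma (real n + 1)\<bar> * u * u ^ k"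
      using u by (simp add: n abs_mult)
    also have "\<dots> \<le> (\<bar>ln u\<bar> + \<bar>Digamma (real n + 1)\<bar>) * u * u ^ k"
      using u by (intro mult_right_mono) auto
    also have "\<dots> = (u * \<bar>ln u\<bar> + \<bar>Digamma (real n + 1)\<bar> * u) * u ^ k"
      by (simp add: algebra_simps)
    also have "\<dots> \<le> (1 + w\<^sup>2 + \<bar>Digamma (real n + 1)\<bar> * w) * w ^ k"
      using u mult_abs_ln_le[OF u] by (intro mult_mono add_mono power_mono) auto
    finally show "\<bar>(ln (t - t0) - Digamma (real n + 1)) * (t - t0) ^ n\<bar> \<le>
        (1 + w\<^sup>2 + \<bar>Digamma (real n + 1)\<bar> * w) * w ^ k"
      by (simp add: u_def)
  qed measurable
qed

lemma RL_operator_monomial: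
  assumes "0 < \<alpha>"
  shows "RL_operator p t0 t1 \<alpha> (Lp_class M p (monomial n)) =
    Lp_class M p (\<lambda>t. (RL_power_factor n \<alpha> * (t - t0) powr (real n + \<alpha>)) *\<^sub>R x)"
proof -
  have "AE t in M. RL_integral t0 \<alpha> (monomial n) t =
      (RL_power_factor n \<alpha> * (t - t0) powr (real n + \<alpha>)) *\<^sub>R x"
    using AE_lebesgue_on_interval[of t0 t1]
    by eventually_elim (simp add: monomial_def[abs_def] RL_integral_power[OF assms])
  then show ?thesis
    unfolding RL_operator_class[OF monomial_in_Lp] by (rule Lp_cong_AE(3))
qed

lemma RL_monomial_in_Lp:
  assumes "0 < \<alpha>"
  shows "(\<lambda>t. (RL_power_factor n \<alpha> * (t - t0) powr (real n + \<alpha>)) *\<^sub>R x) \<in> Lp_functions M p"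
proof (rule bounded_in_Lp(1))
  fix t assume "t0 < t" "t \<le> t1"
  then show "\<bar>RL_power_factor n \<alpha> * (t - t0) powr (real n + \<alpha>)\<bar> \<le>
      \<bar>RL_power_factor n \<alpha>\<bar> * (t1 - t0) powr (real n + \<alpha>)"
    using assms by (auto simp: abs_mult intro!: mult_left_mono powr_mono2)
qed measurable

text \<open>
  Uniform convergence on a set of finite measure implies convergence in every \<open>L\<^sup>p\<close>.
\<close>

lemma generator_limit_monomial:
  assumes "2 \<le> n"
  shows "generator_limit (Lp M p) (RL_operator p t0 t1) (Lp_class M p (monomial n)) (Lp_class M p (log_monomial n))"
proof -
  let ?c = "RL_power_factor n" and ?\<psi> = "Digamma (real n + 1)"
  define err where "err \<alpha> = \<bar>?c \<alpha>\<bar> * \<alpha> + \<bar>?c \<alpha> - 1\<bar> + \<bar>(?c \<alpha> - 1) / \<alpha> + ?\<psi>\<bar>" for \<alpha>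
  define K where "K = (1 + (t1 - t0)) ^ (n + 3) * Lp_seminorm M p (\<lambda>_. x)"
  define d where "d \<alpha> = vnorm (Lp M p) (vdiff (Lp M p) (vscale (Lp M p) (1 / \<alpha>)
      (vdiff (Lp M p) (RL_operator p t0 t1 \<alpha> (Lp_class M p (monomial n))) (Lp_class M p (monomial n))))
      (Lp_class M p (log_monomial n)))" for \<alpha>
  have n: "1 \<le> n"
    using assms by simp
  have d: "d \<alpha> = Lp_seminorm M p (\<lambda>t. ((?c \<alpha> * (t - t0) powr (real n + \<alpha>) - (t - t0) ^ n) / \<alpha> -
      (ln (t - t0) - ?\<psi>) * (t - t0) ^ n) *\<^sub>R x)" (is "_ = Lp_seminorm M p ?q") if "0 < \<alpha>" for \<alpha>
  proof -
    have "?q = (\<lambda>t. (1 / \<alpha>) *\<^sub>R ((?c \<alpha> * (t - t0) powr (real n + \<alpha>)) *\<^sub>R x - monomial n t) - log_monomial n t)"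
      by (simp add: fun_eq_iff monomial_def log_monomial_def scaleR_diff_left[symmetric] diff_divide_distrib)
    then show ?thesis
      unfolding d_def RL_operator_monomial[OF that]
      by (simp add: vnorm_quotient_diff[OF p monomial_in_Lp RL_monomial_in_Lp[OF that] log_monomial_in_Lp[OF n]])
  qed
  have "eventually (\<lambda>\<alpha>. norm (d \<alpha>) \<le> norm (err \<alpha>) * K) (at_right 0)"
    unfolding eventually_at_right_field
  proof (intro exI[of _ 1] conjI allI impI)
    fix \<alpha> :: real assume \<alpha>: "0 < \<alpha>" "\<alpha> < 1"
    have "d \<alpha> \<le> (1 + (t1 - t0)) ^ (n + 3) * err \<alpha> * Lp_seminorm M p (\<lambda>_. x)"
      unfolding d[OF \<alpha>(1)]
    proof (rule bounded_in_Lp(2))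
      fix t assume "t0 < t" "t \<le> t1"
      then show "\<bar>(?c \<alpha> * (t - t0) powr (real n + \<alpha>) - (t - t0) ^ n) / \<alpha> -
          (ln (t - t0) - ?\<psi>) * (t - t0) ^ n\<bar> \<le> (1 + (t1 - t0)) ^ (n + 3) * err \<alpha>"
        unfolding err_def using \<alpha> assms by (intro power_quotient_bound) auto
    qed measurable
    moreover have "0 \<le> d \<alpha>"
      by (simp add: d[OF \<alpha>(1)] Lp_seminorm_def)
    moreover have "0 \<le> err \<alpha>"
      using \<alpha> by (simp add: err_def)
    ultimately show "norm (d \<alpha>) \<le> norm (err \<alpha>) * K"
      by (simp add: K_def mult_ac)
  qed simp
  moreover have "(err \<longlongrightarrow> 0) (at_right 0)"
    unfolding err_def by (rule RL_power_factor_error_tendsto_0)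
  ultimately have "(d \<longlongrightarrow> 0) (at_right 0)"
    by (rule tendsto_0_le[rotated])
  then show ?thesis
    using Lp_class_in_vcarrier[OF log_monomial_in_Lp[OF n]] by (simp add: generator_limit_def d_def[abs_def])
qed

text \<open>
  Since \<open>ln (t - t0) \<le> ln (t1 - t0) < \<psi> (n + 1)\<close>, the multiplier \<open>ln (t - t0) - \<psi> (n + 1)\<close> is
  bounded away from \<open>0\<close> by the value at the right end point.
\<close>

lemma Lp_seminorm_monomial_le:
  assumes "1 \<le> n" and "ln (t1 - t0) < Digamma (real n + 1)"
  shows "(Digamma (real n + 1) - ln (t1 - t0)) * Lp_seminorm M p (monomial n) \<le> Lp_seminorm M p (log_monomial n)"
proof -
  define b where "b = Digamma (real n + 1) - ln (t1 - t0)"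
  have b: "0 < b"
    using assms by (simp add: b_def)
  have "Lp_seminorm M p (monomial n) \<le> (1 / b) * Lp_seminorm M p (log_monomial n)"
  proof (rule Lp_dominated(2)[OF p log_monomial_in_Lp[OF assms(1)]])
    show "strongly_measurable M (monomial n)"
      using monomial_in_Lp by (simp add: Lp_functions_def)
    show "AE t in M. norm (monomial n t) \<le> 1 / b * norm (log_monomial n t)"
      using AE_lebesgue_on_interval[of t0 t1]
    proof eventually_elim
      case (elim t)
      then have "ln (t - t0) \<le> ln (t1 - t0)"
        by simp
      then have "b \<le> \<bar>ln (t - t0) - Digamma (real n + 1)\<bar>"
        by (simp add: b_def)
      then have "b * norm (monomial n t) \<le> \<bar>ln (t - t0) - Digamma (real n + 1)\<bar> * norm (monomial n t)"
        by (rule mult_right_mono) simp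
      also have "\<dots> = norm (log_monomial n t)"
        by (simp add: monomial_def log_monomial_def abs_mult)
      finally show ?case
        using b by (simp add: pos_le_divide_eq mult.commute)
    qed
  qed (use b in simp)
  then show ?thesis
    using b unfolding b_def[symmetric] by (simp add: field_simps)
qed

lemma Lp_seminorm_monomial_pos:
  assumes "x \<noteq> 0"
  shows "0 < Lp_seminorm M p (monomial n)"
proof (rule ccontr)
  assume "\<not> 0 < Lp_seminorm M p (monomial n)"
  moreover have "0 \<le> Lp_seminorm M p (monomial n)"
    by (simp add: Lp_seminorm_def)
  ultimately have "AE t in M. monomial n t = 0"
    by (intro Lp_seminorm_eq_0_imp_AE[OF p monomial_in_Lp]) simp
  then have "AE t in M. False"
    using AE_lebesgue_on_interval[of t0 t1] by eventually_elim (use assms in \<open>simp add: monomial_def\<close>)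
  then have "ae_filter M = bot"
    by (simp add: trivial_limit_def)
  then have "emeasure M (space M) = 0"
    by (simp only: ae_filter_eq_bot_iff)
  moreover have "emeasure M (space M) = ennreal (t1 - t0)"
    using less by (simp add: emeasure_restrict_space)
  ultimately show False
    using less by (simp add: ennreal_eq_0_iff)
qed

end


lemma Digamma_of_nat_at_top: "filterlim (\<lambda>n. Digamma (real n + 1)) at_top sequentially"
proof -
  have "(\<lambda>n. Digamma (real n + 1)) = (\<lambda>n. - euler_mascheroni + harm n)"
    using Digamma_of_nat[where 'a = real] by (simp add: add.commute fun_eq_iff)
  then show ?thesis
    using filterlim_tendsto_add_at_top[OF tendsto_const harm_at_top] by metis
qed

theorem theorem30:
  fixes t0 t1 :: real and p :: ennreal
    and D :: "(real \<Rightarrow> 'a::banach) set set"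
    and A :: "(real \<Rightarrow> 'a) set \<Rightarrow> (real \<Rightarrow> 'a) set"
  assumes "t0 < t1"
    and "\<exists>x::'a. x \<noteq> 0"
    and "1 \<le> p" and "p \<le> \<infinity>"
    and "infinitesimal_generator (Lp_interval p t0 t1) (RL_operator p t0 t1) D A"
  shows "unbounded_operator (Lp_interval p t0 t1) D A"
proof
  obtain x :: 'a where x: "x \<noteq> 0"
    using assms(2) by blast
  interpret interval_Lp t0 t1 p x
    using assms by unfold_locales
  have Y: "Lp_interval p t0 t1 = Lp M p"
    by (simp add: Lp_interval_def)
  assume "bounded_operator (Lp_interval p t0 t1) D A"
  then obtain C where C: "\<And>y. y \<in> D \<Longrightarrow> vnorm (Lp M p) (A y) \<le> C * vnorm (Lp M p) y"
    unfolding bounded_operator_def Y by blast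
  \<comment> \<open>The factor \<open>16\<close> anticipates the loss in passing from the candidate limit to \<open>A\<close>.\<close>
  have "eventually (\<lambda>n. 2 \<le> n \<and> ln (t1 - t0) + max 0 (16 * C) < Digamma (real n + 1)) sequentially"
    using filterlim_at_top_dense[THEN iffD1, OF Digamma_of_nat_at_top] eventually_ge_at_top[of 2]
    by (auto intro: eventually_conj)
  then obtain n where n: "2 \<le> n" "ln (t1 - t0) + max 0 (16 * C) < Digamma (real n + 1)"
    by (auto simp: eventually_sequentially)
  define b where "b = Digamma (real n + 1) - ln (t1 - t0)"
  have b: "0 < b" "16 * C < b"
    using n by (auto simp: b_def)
  let ?y = "Lp_class M p (monomial n)"
  have y: "?y \<in> vcarrier (Lp M p)"
    by (rule Lp_class_in_vcarrier[OF monomial_in_Lp])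
  have D: "?y \<in> D"
    using assms(5) generator_limit_monomial[OF n(1)] y unfolding infinitesimal_generator_def Y by blast
  have "b * Lp_seminorm M p (monomial n) \<le> Lp_seminorm M p (log_monomial n)"
    unfolding b_def using n b by (intro Lp_seminorm_monomial_le) (auto simp: b_def)
  also have "\<dots> = vnorm (Lp M p) (Lp_class M p (log_monomial n))"
    using n by (simp add: vnorm_Lp_class log_monomial_in_Lp)
  also have "\<dots> \<le> 16 * vnorm (Lp M p) (A ?y)"
  proof (rule generator_limit_Lp_comparable[OF p y])
    show "RL_operator p t0 t1 \<alpha> ?y \<in> vcarrier (Lp M p)" if "0 < \<alpha>" for \<alpha>
      unfolding RL_operator_monomial[OF that] by (rule Lp_class_in_vcarrier[OF RL_monomial_in_Lp[OF that]])
    show "generator_limit (Lp M p) (RL_operator p t0 t1) ?y (A ?y)"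
      using assms(5) D unfolding infinitesimal_generator_def Y by blast
  qed (rule generator_limit_monomial[OF n(1)])
  also have "\<dots> \<le> 16 * (C * Lp_seminorm M p (monomial n))"
    using C[OF D] by (simp add: vnorm_Lp_class monomial_in_Lp)
  finally have "b * Lp_seminorm M p (monomial n) \<le> (16 * C) * Lp_seminorm M p (monomial n)"
    by simp
  then have "b \<le> 16 * C"
    using Lp_seminorm_monomial_pos[OF x] by simp
  then show False
    using b by simp
qed

end
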